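(* Let $\mu$ be a Borel probability measure on $C[0,1]$. Then there exists a function $g\in C[0,1]$ such that $$\mu(\{f\in C[0,1]: \mathcal{Z}(f-g)\text{ is a singleton}\})>0.$$ Consequently, the set $\{f\in C[0,1]: \mathcal{Z}(f)\text{ is a singleton}\}$ is non-shy in $C[0,1]$.
   Context: $C[0,1]$ is the Banach space of continuous functions $[0,1]\to\mathbb{R}$ with the maximum norm (an abelian Polish group under addition). For $f\in C[0,1]$, $\mathcal{Z}(f)=\{x\in[0,1]: f(x)=0\}$. Shyness: for an abelian Polish group $G$, a set $A\subset G$ is shy if there exist a Borel set $B\supset A$ in $G$ and a Borel probability measure $\nu$ on $G$ with $\nu(B+x)=0$ for all $x\in G$; non-shy means not shy. *)

theory Defs
  imports "HOL-Probability.Probability"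
begin

typedef unit_interval = "{0..1::real}"
  morphisms real_of_ui ui_of_real
  by (rule exI[of _ 0]) simp

instantiation unit_interval :: metric_space
begin

definition dist_unit_interval :: "unit_interval \<Rightarrow> unit_interval \<Rightarrow> real"
  where "dist_unit_interval x y = dist (real_of_ui x) (real_of_ui y)"

definition uniformity_unit_interval :: "(unit_interval \<times> unit_interval) filter"
  where "uniformity_unit_interval = (INF e\<in>{0<..}. principal {(x, y). dist x y < e})"

definition open_unit_interval :: "unit_interval set \<Rightarrow> bool"
  where "open_unit_interval U \<longleftrightarrow> (\<forall>x\<in>U. \<forall>\<^sub>F (x', y) in uniformity. x' = x \<longrightarrow> y \<in> U)"

instance
proof
  fix x y z :: unit_interval
  show "dist x y = 0 \<longleftrightarrow> x = y"
    by (simp add: dist_unit_interval_def real_of_ui_inject)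
  show "dist x y \<le> dist x z + dist y z"
    unfolding dist_unit_interval_def by (rule dist_triangle2)
qed (simp_all only: uniformity_unit_interval_def open_unit_interval_def)

end

(* Since [0,1] is compact, bounded continuous functions on it are just the continuous ones, and
   the supremum norm of the library type is the maximum norm. *)
type_synonym C01 = "unit_interval \<Rightarrow>\<^sub>C real"

definition zero_set :: "C01 \<Rightarrow> unit_interval set"
  where "zero_set f = {x. apply_bcontfun f x = 0}"

(* The notion is meant for Polish groups; its defining condition makes sense in every abelian
   topological group, so Polishness is not imposed as a sort constraint. *)
definition shy :: "'a::topological_ab_group_add set \<Rightarrow> bool"
  where "shy A \<longleftrightarrow>
    (\<exists>B \<nu>. B \<in> sets (borel :: 'a measure) \<and> A \<subseteq> B \<and>
      prob_space \<nu> \<and> sets \<nu> = sets (borel :: 'a measure) \<and>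
      (\<forall>x. emeasure \<nu> ((\<lambda>b. b + x) ` B) = 0))"

end

theory Submission
  imports Defs
begin

text \<open>
  Outside small \<open>\<mu>\<close>-measure all \<open>f\<close> share a bound \<open>R\<close> and a modulus of continuity. Against this modulus
  one can choose a singular increasing \<open>\<phi>\<close>, the continuous inverse of a pure jump function whose jump
  at the \<open>k\<close>-th rational \<open>q k\<close> has a tiny size \<open>c k\<close>. If \<open>\<phi> - f\<close> takes a value \<open>u\<close> at two points, the
  largest jump between them forces \<open>u\<close> to lie close to \<open>q k - f (p k)\<close> for some \<open>k\<close>, where \<open>p k\<close> is a
  fixed point of the \<open>k\<close>-th gap; so for each such \<open>f\<close> all \<open>u\<close> in \<open>{R<..<R+1}\<close>, except for a set of
  measure less than 1, are attained exactly once. By Fubini some fixed \<open>u\<close> works for a set of \<open>f\<close> of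
  positive measure, and \<open>g = \<phi> - u\<close>.
\<close>

section \<open>Continuous inverses of jump functions\<close>

text \<open>A left inverse of \<open>\<psi>\<close> defined on all reals is onto, and a monotone
  surjection cannot jump. So the generalised inverse is continuous however many jumps
  \<open>\<psi>\<close> has.\<close>

lemma strict_mono_continuous_left_inverse:
  fixes \<psi> :: "real \<Rightarrow> real"
  assumes "strict_mono \<psi>" and lo: "\<And>x. \<exists>t. \<psi> t \<le> x" and hi: "\<And>x. \<exists>t. x < \<psi> t"
  obtains \<phi> where "mono \<phi>" "continuous_on UNIV \<phi>" "\<And>t. \<phi> (\<psi> t) = t"
proof -
  define \<phi> where "\<phi> x = Sup {t. \<psi> t \<le> x}" for x
  have less: "\<psi> s < \<psi> t \<longleftrightarrow> s < t" for s t
    using assms(1) by (simp add: strict_mono_less)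
  have bdd: "bdd_above {t. \<psi> t \<le> x}" for x
  proof -
    obtain b where "x < \<psi> b" using hi by blast
    then have "t \<le> b" if "\<psi> t \<le> x" for t
      using that less[of b t] by linarith
    then show ?thesis by (auto intro!: bdd_aboveI)
  qed
  have mono: "mono \<phi>"
    unfolding \<phi>_def
    by (rule monoI, rule cSup_subset_mono) (use lo bdd in auto)
  have inv: "\<phi> (\<psi> t) = t" for t
    unfolding \<phi>_def
    using strict_mono_less_eq[OF assms(1)] by (intro cSup_eq_maximum) auto
  then have "range \<phi> = UNIV" by (metis surj_def)
  then have "continuous_on UNIV \<phi>"
    using mono by (intro continuous_onI_mono) (auto simp: mono_def)
  with mono inv show thesis using that by blast
qed

text \<open>For summable \<open>c\<close> the strict comparison makes this left-continuous, so
  increments count the jumps in half-open intervals. Where \<open>q\<close> repeats a value the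
  weights add up.\<close>

definition jump_sum :: "(nat \<Rightarrow> real) \<Rightarrow> (nat \<Rightarrow> real) \<Rightarrow> real \<Rightarrow> real"
  where "jump_sum c q t = (\<Sum>k. if q k < t then c k else 0)"

context
  fixes c :: "nat \<Rightarrow> real"
  assumes c_pos: "\<And>k. 0 < c k" and c_half: "\<And>k. c (Suc k) \<le> c k / 2"
begin

lemma halving_bound: "c (n + k) \<le> c k * (1/2) ^ n"
proof (induction n)
  case (Suc n)
  then show ?case using c_half[of "n + k"] by simp
qed simp

lemma summable_halving: "summable c"
proof (rule summable_comparison_test)
  show "\<exists>N. \<forall>n\<ge>N. norm (c n) \<le> c 0 * (1/2) ^ n"
    using halving_bound[of _ 0] c_pos by (auto simp: abs_of_pos)
qed (intro summable_mult summable_geometric, simp)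

lemma halving_tail: "(\<Sum>n. c (n + k)) \<le> 2 * c k"
proof -
  have "(\<Sum>n. c (n + k)) \<le> (\<Sum>n. c k * (1/2) ^ n)"
    by (intro suminf_le halving_bound summable_mult summable_geometric
        summable_ignore_initial_segment summable_halving) simp
  also have "\<dots> = 2 * c k"
    by (subst suminf_mult) (simp_all add: suminf_geometric)
  finally show ?thesis .
qed

lemma summable_jumps: "summable (\<lambda>k. if P k then c k else 0)"
  using c_pos less_imp_le
  by (intro summable_comparison_test'[OF summable_halving, of 0]) auto

lemma jump_sum_bounds: "0 \<le> jump_sum c q t" "jump_sum c q t \<le> 2 * c 0"
proof -
  show "0 \<le> jump_sum c q t"
    unfolding jump_sum_def using c_pos less_imp_le
    by (intro suminf_nonneg summable_jumps) auto
  have "jump_sum c q t \<le> suminf c"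
    unfolding jump_sum_def using c_pos less_imp_le
    by (intro suminf_le summable_jumps summable_halving) auto
  also have "\<dots> \<le> 2 * c 0" using halving_tail[of 0] by simp
  finally show "jump_sum c q t \<le> 2 * c 0" .
qed

lemma jump_sum_diff:
  assumes "t \<le> s"
  shows "jump_sum c q s - jump_sum c q t = (\<Sum>k. if t \<le> q k \<and> q k < s then c k else 0)"
  unfolding jump_sum_def
  by (subst suminf_diff[OF summable_jumps summable_jumps], rule suminf_cong) (use assms in auto)

lemma jump_sum_strict_mono:
  assumes dense: "\<And>a b. a < b \<Longrightarrow> \<exists>k. a < q k \<and> q k < (b::real)"
  shows "strict_mono (jump_sum c q)"
proof (rule strict_monoI)
  fix t s :: real assume "t < s"
  then obtain k where k: "t < q k" "q k < s" using dense by blast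
  have "0 < (\<Sum>k. if t \<le> q k \<and> q k < s then c k else 0)"
    by (rule suminf_pos2[OF summable_jumps, of _ k])
      (use k c_pos less_imp_le in auto)
  then show "jump_sum c q t < jump_sum c q s"
    using jump_sum_diff[of t s q] \<open>t < s\<close> by simp
qed

text \<open>Only indices from \<open>k\<close> on contribute, and halving bounds this tail by twice
  its first weight. Thus the lowest-indexed jump in an interval controls the whole
  increment.\<close>

lemma jump_sum_diff_le:
  assumes "t \<le> s" and "\<And>j. j < k \<Longrightarrow> \<not> (t \<le> q j \<and> q j < s)"
  shows "jump_sum c q s - jump_sum c q t \<le> 2 * c k"
proof -
  let ?g = "\<lambda>j. if t \<le> q j \<and> q j < s then c j else 0"
  have "suminf ?g = (\<Sum>n. ?g (n + k)) + (\<Sum>i<k. ?g i)"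
    by (rule suminf_split_initial_segment[OF summable_jumps])
  also have "(\<Sum>i<k. ?g i) = 0"
    using assms(2) by (intro sum.neutral) auto
  also have "(\<Sum>n. ?g (n + k)) \<le> (\<Sum>n. c (n + k))"
    using c_pos less_imp_le
    by (intro suminf_le summable_ignore_initial_segment[OF summable_jumps]
        summable_ignore_initial_segment[OF summable_halving]) auto
  also have "\<dots> \<le> 2 * c k" by (rule halving_tail)
  finally show ?thesis using jump_sum_diff[OF assms(1), of q] by simp
qed

text \<open>\<open>\<phi>\<close>, \<open>q\<close> and \<open>p\<close> are fixed before
  \<open>F\<close>. The exceptional values of \<open>u\<close> lie in intervals whose centres depend
  on \<open>F\<close> but whose radii \<open>3 * \<epsilon> k\<close> do not, so their total length
  is bounded uniformly in \<open>F\<close>.\<close>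

lemma steep_function_exists:
  fixes R :: real and \<epsilon> :: "nat \<Rightarrow> real"
  assumes "c 0 \<le> 1/2" and "0 \<le> R" and \<epsilon>_pos: "\<And>k. 0 < \<epsilon> k" and "antimono \<epsilon>"
  obtains \<phi> :: "real \<Rightarrow> real" and q p :: "nat \<Rightarrow> real"
  where "mono \<phi>" "continuous_on UNIV \<phi>"
    "\<forall>F u. continuous_on UNIV F \<and> (\<forall>x. \<bar>F x\<bar> \<le> R) \<and>
        (\<forall>k x y. \<bar>x - y\<bar> \<le> 2 * c k \<longrightarrow> \<bar>F x - F y\<bar> \<le> \<epsilon> k) \<and> R < u \<and> u < R + 1 \<and>
        (\<forall>k. 3 * \<epsilon> k < \<bar>u - (q k - F (p k))\<bar>)
      \<longrightarrow> (\<exists>!x. x \<in> {0..1} \<and> \<phi> x - F x = u)"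
proof -
  \<comment> \<open>Since \<open>\<bar>F x\<bar> \<le> R\<close> and \<open>R < u < R + 1\<close>,
    every solution has \<open>\<phi> x = u + F x\<close> strictly between 0 and
    \<open>M\<close>.\<close>
  define M where "M = 2 * R + 1"
  define q where "q n = real_of_rat (nat_to_rat_surj n)" for n
  have dense: "\<exists>k. a < q k \<and> q k < b" if ab: "a < b" for a b
  proof -
    obtain r where "r \<in> \<rat>" "a < r" "r < b" using Rats_dense_in_real[OF ab] by blast
    then show ?thesis
      unfolding q_def by (metis Rats_cases surj_def surj_nat_to_rat_surj)
  qed
  \<comment> \<open>The correction vanishes on \<open>{0..M}\<close>; it only makes \<open>\<psi>\<close> unbounded, so that \<open>\<phi>\<close> is total.\<close>
  define \<psi> where "\<psi> t = jump_sum c q t + (min t 0 + max (t - M) 0)" for t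
  have sm: "strict_mono \<psi>"
  proof (rule strict_monoI)
    fix t s :: real assume "t < s"
    then have "jump_sum c q t < jump_sum c q s"
      using jump_sum_strict_mono[OF dense] by (simp add: strict_mono_less)
    then show "\<psi> t < \<psi> s" unfolding \<psi>_def using \<open>t < s\<close> by auto
  qed
  have lo: "\<exists>t. \<psi> t \<le> x" for x
    using jump_sum_bounds(2)[of q "min (x - 2 * c 0) 0"] assms(1,2)
    by (intro exI[of _ "min (x - 2 * c 0) 0"]) (auto simp: \<psi>_def M_def)
  have hi: "\<exists>t. x < \<psi> t" for x
    using jump_sum_bounds(1)[of q "max 0 (x + M + 1)"] assms(1,2)
    by (intro exI[of _ "max 0 (x + M + 1)"]) (auto simp: \<psi>_def M_def)
  obtain \<phi> where \<phi>: "mono \<phi>" "continuous_on UNIV \<phi>" and inv: "\<And>t. \<phi> (\<psi> t) = t"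
    using strict_mono_continuous_left_inverse[OF sm lo hi] by blast
  have \<phi>0: "\<phi> 0 \<le> 0"
  proof -
    have "0 \<le> \<psi> 0" using jump_sum_bounds(1)[of q 0] assms(2) by (simp add: \<psi>_def M_def)
    then show ?thesis using monoD[OF \<phi>(1)] inv[of 0] by metis
  qed
  \<comment> \<open>Here \<open>c 0 \<le> 1/2\<close> bounds the sum of all jumps by 1, so
    \<open>\<phi>\<close> reaches \<open>M\<close> within the unit interval.\<close>
  have \<phi>1: "M \<le> \<phi> 1"
  proof -
    have "\<psi> M \<le> 1" using jump_sum_bounds(2)[of q M] assms(1,2) by (simp add: \<psi>_def M_def)
    then show ?thesis using monoD[OF \<phi>(1)] inv[of M] by metis
  qed
  have \<psi>_le: "\<psi> s \<le> x" if "s < \<phi> x" for s x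
    using that inv[of s] monoD[OF \<phi>(1), of x "\<psi> s"] by linarith
  \<comment> \<open>Strictness matters: \<open>\<phi>\<close> is constantly \<open>s\<close> on the
    gap at a rational \<open>s\<close>, so \<open>\<phi> x = s\<close> would not give
    \<open>x \<le> \<psi> s\<close>.\<close>
  have \<psi>_ge: "x \<le> \<psi> s" if "\<phi> x < s" for s x
    using that inv[of s] monoD[OF \<phi>(1), of "\<psi> s" x] by linarith
  have "\<exists>!x. x \<in> {0..1} \<and> \<phi> x - F x = u"
    if F: "continuous_on UNIV F" "\<And>x. \<bar>F x\<bar> \<le> R"
      "\<And>k x y. \<bar>x - y\<bar> \<le> 2 * c k \<Longrightarrow> \<bar>F x - F y\<bar> \<le> \<epsilon> k"
      and u: "R < u" "u < R + 1" "\<And>k. 3 * \<epsilon> k < \<bar>u - (q k - F (\<psi> (q k)))\<bar>"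
    for F u
  proof -
    have "\<exists>x. 0 \<le> x \<and> x \<le> 1 \<and> \<phi> x - F x = u"
    proof (rule IVT')
      show "\<phi> 0 - F 0 \<le> u" using F(2)[of 0] \<phi>0 u by linarith
      show "u \<le> \<phi> 1 - F 1" using F(2)[of 1] \<phi>1 u by (simp add: M_def abs_le_iff)
      show "continuous_on {0..1} (\<lambda>x. \<phi> x - F x)"
        using F(1) \<phi>(2) by (intro continuous_on_diff) (auto intro: continuous_on_subset)
    qed simp
    \<comment> \<open>The factor 3 arises as follows: \<open>\<phi> x\<close> is within
      \<open>2 * \<epsilon> k\<close> of \<open>q k\<close>, one \<open>\<epsilon> k\<close> for the
      oscillation of \<open>F\<close> and one for the enlargement by \<open>\<eta>\<close>;
      replacing \<open>F x\<close> by \<open>F (\<psi> (q k))\<close> costs a third.\<close>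
    moreover have False if xy: "x < y" "\<phi> x - F x = u" "\<phi> y - F y = u" for x y
    proof -
      let ?t = "\<phi> x" and ?s = "\<phi> y"
      have ts: "0 < ?t" "?t \<le> ?s" "?s < M"
        using F(2)[of x] F(2)[of y] u xy monoD[OF \<phi>(1), of x y]
        by (auto simp: M_def abs_le_iff)
      have "(\<lambda>k. 2 * c k) \<longlonglongrightarrow> 0"
        using tendsto_mult[OF tendsto_const summable_LIMSEQ_zero[OF summable_halving], of 2] by simp
      then have "eventually (\<lambda>k. 2 * c k < y - x) sequentially"
        by (rule order_tendstoD) (use xy in simp)
      then obtain N where N: "2 * c k < y - x" if "k \<ge> N" for k
        by (auto simp: eventually_sequentially)
      \<comment> \<open>Room for enlarging \<open>{?t..?s}\<close>, which may be a single rational; \<open>\<epsilon> N\<close> bounds from below the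
        \<open>\<epsilon> k\<close> of every jump that can be relevant.\<close>
      define \<eta> where "\<eta> = Min {\<epsilon> N / 2, ?t / 2, (M - ?s) / 2}"
      have \<eta>: "0 < \<eta>" "\<eta> \<le> \<epsilon> N / 2" "\<eta> < ?t" "\<eta> < M - ?s"
        using ts \<epsilon>_pos[of N] by (auto simp: \<eta>_def min_less_iff_disj)
      define t' s' where "t' = ?t - \<eta>" and "s' = ?s + \<eta>"
      have t's': "0 < t'" "t' < ?t" "?s < s'" "s' < M" "t' < s'"
        using \<eta> ts by (auto simp: t'_def s'_def)
      \<comment> \<open>As \<open>c\<close> decreases, the least index carries the largest weight in
        the enlarged interval.\<close>
      define k where "k = (LEAST k. t' \<le> q k \<and> q k < s')"
      have k: "t' \<le> q k" "q k < s'" and least: "\<And>j. j < k \<Longrightarrow> \<not> (t' \<le> q j \<and> q j < s')"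
      proof -
        obtain j where "t' < q j" "q j < s'" using dense t's'(5) by blast
        then have "\<exists>j. t' \<le> q j \<and> q j < s'" by (auto intro: less_imp_le)
        from LeastI_ex[OF this] show "t' \<le> q k" "q k < s'" by (auto simp: k_def)
        show "\<And>j. j < k \<Longrightarrow> \<not> (t' \<le> q j \<and> q j < s')"
          unfolding k_def by (rule not_less_Least)
      qed
      have "\<psi> s' - \<psi> t' \<le> 2 * c k"
        using jump_sum_diff_le[OF _ least] t's' by (simp add: \<psi>_def)
      moreover have "\<psi> t' \<le> x" "x \<le> \<psi> s'" "\<psi> t' \<le> y" "y \<le> \<psi> s'"
        using t's' ts xy by (auto intro!: \<psi>_le \<psi>_ge)
      moreover have "\<psi> t' \<le> \<psi> (q k)" "\<psi> (q k) \<le> \<psi> s'"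
        using k strict_mono_less_eq[OF sm] by auto
      ultimately have close: "\<bar>y - x\<bar> \<le> 2 * c k" "\<bar>x - \<psi> (q k)\<bar> \<le> 2 * c k" by auto
      have "k < N" using N[of k] close(1) xy(1) by (cases "k < N") auto
      then have "\<epsilon> N \<le> \<epsilon> k" using monotoneD[OF \<open>antimono \<epsilon>\<close>, of k N] by simp
      \<comment> \<open>Both points solve the equation, so
        \<open>\<phi> y - \<phi> x = F y - F x\<close>, which is at most
        \<open>\<epsilon> k\<close>; and
        \<open>2 * \<eta> \<le> \<epsilon> N \<le> \<epsilon> k\<close>.\<close>
      then have "s' - t' \<le> 2 * \<epsilon> k"
        using F(3)[OF close(1)] xy \<eta> by (simp add: s'_def t'_def)
      then have "\<bar>?t - q k\<bar> \<le> 2 * \<epsilon> k"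
        using k t's' ts by auto
      then have "\<bar>u - (q k - F (\<psi> (q k)))\<bar> \<le> 3 * \<epsilon> k"
        using F(3)[OF close(2)] xy(2) by auto
      then show False using u(3)[of k] by linarith
    qed
    ultimately show ?thesis
      by (metis atLeastAtMost_iff linorder_neqE_linordered_idom)
  qed
  then show thesis
    by (intro that[of \<phi> q "\<lambda>k. \<psi> (q k)"] \<phi> allI impI) (elim conjE, metis)
qed

end

section \<open>Measurability of having exactly one zero\<close>

lemma Ex1_iff_no_pair:
  "(\<exists>!x. P x) \<longleftrightarrow> (\<exists>x. P x) \<and> \<not> (\<exists>x y. x < (y :: 'a::linorder) \<and> P x \<and> P y)"
  by (metis linorder_neqE less_irrefl)

text \<open>Turns the existence of a zero into countably many conditions on rational evaluations.
  Forwards, \<open>a < b\<close> provides rationals of the interval near the zero; backwards,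
  \<open>\<bar>h\<bar>\<close> attains its minimum by compactness, and that minimum must be
  0.\<close>

lemma zero_in_interval_iff_rational:
  fixes h :: "real \<Rightarrow> real" and a b :: real
  assumes "a < b" and h: "continuous_on {a..b} h"
  shows "(\<exists>x\<in>{a..b}. h x = 0) \<longleftrightarrow>
    (\<forall>n::nat. \<exists>r::rat. of_rat r \<in> {a..b} \<and> \<bar>h (of_rat r)\<bar> < 1 / Suc n)"
proof
  assume "\<exists>x\<in>{a..b}. h x = 0"
  then obtain z where z: "z \<in> {a..b}" "h z = 0" by blast
  show "\<forall>n::nat. \<exists>r::rat. of_rat r \<in> {a..b} \<and> \<bar>h (of_rat r)\<bar> < 1 / Suc n"
  proof
    fix n :: nat
    obtain d where d: "d > 0" "\<And>x. x \<in> {a..b} \<Longrightarrow> dist x z < d \<Longrightarrow> dist (h x) (h z) < 1 / Suc n"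
      using h z(1) unfolding continuous_on_iff by (metis of_nat_0_less_iff zero_less_Suc zero_less_divide_1_iff)
    have "max a (z - d) < min b (z + d)" using z d(1) assms(1) by auto
    from Rats_dense_in_real[OF this] obtain r
      where "max a (z - d) < of_rat r" "of_rat r < min b (z + d)"
      by (metis Rats_cases)
    then show "\<exists>r::rat. of_rat r \<in> {a..b} \<and> \<bar>h (of_rat r)\<bar> < 1 / Suc n"
      using d(2)[of "of_rat r"] z by (intro exI[of _ r]) (auto simp: dist_real_def)
  qed
next
  assume *: "\<forall>n::nat. \<exists>r::rat. of_rat r \<in> {a..b} \<and> \<bar>h (of_rat r)\<bar> < 1 / Suc n"
  have "\<exists>z\<in>{a..b}. \<forall>x\<in>{a..b}. \<bar>h z\<bar> \<le> \<bar>h x\<bar>"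
    using assms by (intro continuous_attains_inf continuous_intros) auto
  then obtain z where z: "z \<in> {a..b}" "\<And>x. x \<in> {a..b} \<Longrightarrow> \<bar>h z\<bar> \<le> \<bar>h x\<bar>" by blast
  have "\<bar>h z\<bar> < 1 / Suc n" for n
    using * z(2) by (meson order_le_less_trans)
  then have "\<not> 0 < \<bar>h z\<bar>"
    by (metis nat_approx_posE not_less_iff_gr_or_eq)
  then show "\<exists>x\<in>{a..b}. h x = 0" using z(1) by auto
qed

text \<open>Uniqueness fails exactly when rationals \<open>a < b\<close> separate two zeros. Two
  rationals make \<open>{0..a}\<close> and \<open>{b..1}\<close> disjoint, and \<open>0 < a\<close>,
  \<open>b < 1\<close> keep both intervals nondegenerate, so that the rational criterion
  applies.\<close>

lemma pred_unique_zero: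
  fixes H :: "'a \<Rightarrow> real \<Rightarrow> real"
  assumes cont: "\<And>w. continuous_on {0..1} (H w)"
    and meas[measurable]: "\<And>x. (\<lambda>w. H w x) \<in> borel_measurable M"
  shows "Measurable.pred M (\<lambda>w. \<exists>!x. x \<in> {0..1} \<and> H w x = 0)"
proof -
  define Z where "Z a b w \<longleftrightarrow> (\<forall>n::nat. \<exists>r::rat. of_rat r \<in> {a..b} \<and> \<bar>H w (of_rat r)\<bar> < 1 / Suc n)"
    for a b :: real and w
  have Z: "Z a b w \<longleftrightarrow> (\<exists>x\<in>{a..b}. H w x = 0)" if "0 \<le> a" "a < b" "b \<le> 1" for a b w
    unfolding Z_def using that
    by (intro zero_in_interval_iff_rational[symmetric] continuous_on_subset[OF cont]) auto
  have [measurable]: "Measurable.pred M (Z a b)" for a b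
    unfolding Z_def by measurable
  have "(\<exists>!x. x \<in> {0..1} \<and> H w x = 0) \<longleftrightarrow> Z 0 1 w \<and>
      \<not> (\<exists>a b :: rat. 0 < real_of_rat a \<and> real_of_rat a < of_rat b \<and> real_of_rat b < 1 \<and> Z 0 (of_rat a) w \<and> Z (of_rat b) 1 w)"
    (is "?L \<longleftrightarrow> ?A \<and> \<not> ?B") for w
  proof -
    have "?A \<longleftrightarrow> (\<exists>x\<in>{0..1}. H w x = 0)" by (simp add: Z)
    moreover have "?B \<longleftrightarrow> (\<exists>x y. 0 \<le> x \<and> x < y \<and> y \<le> 1 \<and> H w x = 0 \<and> H w y = 0)" (is "_ \<longleftrightarrow> ?C")
    proof
      assume ?B
      then obtain a b where ab: "0 < real_of_rat a" "real_of_rat a < of_rat b" "real_of_rat b < 1"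
        "Z 0 (of_rat a) w" "Z (of_rat b) 1 w" by blast
      then have "\<exists>x\<in>{0..of_rat a}. H w x = 0" "\<exists>x\<in>{of_rat b..1}. H w x = 0"
        using Z[of 0 "of_rat a" w] Z[of "of_rat b" 1 w] by linarith+
      then show ?C using ab by force
    next
      assume ?C
      then obtain x y where xy: "0 \<le> x" "x < y" "y \<le> 1" "H w x = 0" "H w y = 0" by blast
      obtain \<alpha> where \<alpha>: "\<alpha> \<in> \<rat>" "x < \<alpha>" "\<alpha> < y"
        using Rats_dense_in_real[OF xy(2)] by blast
      obtain \<beta> where \<beta>: "\<beta> \<in> \<rat>" "\<alpha> < \<beta>" "\<beta> < y"
        using Rats_dense_in_real[OF \<alpha>(3)] by blast
      have "0 < \<alpha>" "\<beta> < 1" using \<alpha> \<beta> xy by auto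
      moreover have "Z 0 \<alpha> w" "Z \<beta> 1 w"
        using Z[of 0 \<alpha> w] Z[of \<beta> 1 w] \<alpha> \<beta> xy by auto
      ultimately show ?B using \<alpha> \<beta> by (metis Rats_cases)
    qed
    moreover have "?C \<longleftrightarrow> (\<exists>x y. x < y \<and> (x \<in> {0..1} \<and> H w x = 0) \<and> y \<in> {0..1} \<and> H w y = 0)"
      by force
    ultimately show ?thesis unfolding Ex1_iff_no_pair by blast
  qed
  then show ?thesis by simp
qed

section \<open>Passing between the unit interval and the real line\<close>

lemma real_of_ui_bounds [simp]: "0 \<le> real_of_ui x" "real_of_ui x \<le> 1"
  using real_of_ui[of x] by auto

lemma continuous_on_real_of_ui: "continuous_on A real_of_ui"
  unfolding continuous_on_iff dist_unit_interval_def by blast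

text \<open>A 1-Lipschitz retraction: composing with it extends a function on the unit interval to
  the whole line with the same bound and modulus of continuity.\<close>

definition clamp01 :: "real \<Rightarrow> unit_interval"
  where "clamp01 x = ui_of_real (max 0 (min 1 x))"

lemma real_of_clamp01: "real_of_ui (clamp01 x) = max 0 (min 1 x)"
  unfolding clamp01_def by (rule ui_of_real_inverse) auto

lemma clamp01_real_of_ui [simp]: "clamp01 (real_of_ui x) = x"
  by (simp add: clamp01_def real_of_ui_inverse)

lemma dist_clamp01_le: "dist (clamp01 x) (clamp01 y) \<le> \<bar>x - y\<bar>"
  by (auto simp: dist_unit_interval_def real_of_clamp01 dist_real_def)

lemma continuous_on_clamp01: "continuous_on A clamp01"
  unfolding continuous_on_iff
  by (metis dist_clamp01_le dist_real_def order_le_less_trans)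

lemma is_singleton_zero_set_iff:
  "is_singleton (zero_set f) \<longleftrightarrow> (\<exists>!x. x \<in> {0..1} \<and> apply_bcontfun f (clamp01 x) = 0)"
proof -
  have "is_singleton (zero_set f) \<longleftrightarrow> (\<exists>!x. apply_bcontfun f x = 0)"
    by (auto simp: is_singleton_def zero_set_def set_eq_iff)
  also have "\<dots> \<longleftrightarrow> (\<exists>!x. x \<in> {0..1} \<and> apply_bcontfun f (clamp01 x) = 0)"
  proof (intro iffI; elim ex1E)
    fix x assume x: "apply_bcontfun f x = 0" "\<forall>y. apply_bcontfun f y = 0 \<longrightarrow> y = x"
    show "\<exists>!x. x \<in> {0..1} \<and> apply_bcontfun f (clamp01 x) = 0"
    proof (rule ex1I[of _ "real_of_ui x"])
      fix y assume y: "y \<in> {0..1} \<and> apply_bcontfun f (clamp01 y) = 0"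
      then have "real_of_ui (clamp01 y) = real_of_ui x" using x by metis
      then show "y = real_of_ui x" using y by (simp add: real_of_clamp01)
    qed (use x(1) in simp)
  next
    fix x assume x: "x \<in> {0..1} \<and> apply_bcontfun f (clamp01 x) = 0"
      "\<forall>y. y \<in> {0..1} \<and> apply_bcontfun f (clamp01 y) = 0 \<longrightarrow> y = x"
    show "\<exists>!x. apply_bcontfun f x = 0"
    proof (rule ex1I[of _ "clamp01 x"])
      fix y assume "apply_bcontfun f y = 0"
      then have "real_of_ui y = x" by (intro x(2)[rule_format]) simp
      then show "y = clamp01 x" by auto
    qed (use x(1) in simp)
  qed
  finally show ?thesis .
qed

lemma continuous_on_apply_clamp01: "continuous_on A (\<lambda>x. apply_bcontfun f (clamp01 x))"
  by (intro continuous_on_compose2[OF continuous_on_apply_bcontfun continuous_on_clamp01]) auto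

lemma continuous_on_eval_bcontfun: "continuous_on A (\<lambda>f. apply_bcontfun f x)"
  unfolding continuous_on_iff by (metis dist_bounded order_le_less_trans)

lemma measurable_eval_bcontfun [measurable]:
  "(\<lambda>f. apply_bcontfun f x) \<in> borel_measurable borel"
  by (intro borel_measurable_continuous_onI continuous_on_eval_bcontfun)

section \<open>Bounds and moduli of continuity outside small measure\<close>

text \<open>The nonstrict bound by \<open>\<epsilon>\<close> makes the set closed, hence
  Borel.\<close>

definition small_oscillation :: "real \<Rightarrow> real \<Rightarrow> C01 set"
  where "small_oscillation \<epsilon> \<delta> =
    {f. \<forall>x y. dist x y \<le> \<delta> \<longrightarrow> \<bar>apply_bcontfun f x - apply_bcontfun f y\<bar> \<le> \<epsilon>}"

lemma closed_small_oscillation: "closed (small_oscillation \<epsilon> \<delta>)"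
  unfolding small_oscillation_def
  by (intro closed_Collect_all closed_Collect_imp open_Collect_const closed_Collect_le
      continuous_intros continuous_on_eval_bcontfun)

lemma small_oscillation_antimono: "\<delta> \<le> \<delta>' \<Longrightarrow> small_oscillation \<epsilon> \<delta>' \<subseteq> small_oscillation \<epsilon> \<delta>"
  by (auto simp: small_oscillation_def)

lemma ex_small_oscillation:
  assumes "0 < \<epsilon>"
  shows "\<exists>\<delta>>0. f \<in> small_oscillation \<epsilon> \<delta>"
proof -
  have "uniformly_continuous_on {0..1} (\<lambda>x. apply_bcontfun f (clamp01 x))"
    by (intro compact_uniformly_continuous continuous_on_apply_clamp01) simp
  then obtain d where d: "d > 0"
    "\<And>x y. x \<in> {0..1} \<Longrightarrow> y \<in> {0..1} \<Longrightarrow> dist y x < d \<Longrightarrow>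
      dist (apply_bcontfun f (clamp01 y)) (apply_bcontfun f (clamp01 x)) < \<epsilon>"
    unfolding uniformly_continuous_on_def using assms by metis
  have "\<bar>apply_bcontfun f x - apply_bcontfun f y\<bar> \<le> \<epsilon>" if "dist x y \<le> d / 2" for x y
    using that d(1) d(2)[of "real_of_ui y" "real_of_ui x"]
    by (simp add: dist_unit_interval_def dist_real_def)
  then show ?thesis
    using d(1) by (intro exI[of _ "d / 2"]) (auto simp: small_oscillation_def)
qed

context prob_space
begin

lemma incseq_compl_prob_less:
  fixes A :: "nat \<Rightarrow> 'a set"
  assumes "range A \<subseteq> events" "incseq A" "(\<Union>n. A n) = space M" "0 < e"
  shows "\<exists>n. prob (space M - A n) < e"
proof -
  have "(\<lambda>n. prob (A n)) \<longlonglongrightarrow> prob (\<Union>n. A n)"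
    using assms by (intro finite_Lim_measure_incseq)
  then have "eventually (\<lambda>n. 1 - e < prob (A n)) sequentially"
    using assms(3,4) by (intro order_tendstoD(1)[where y = 1]) (auto simp: prob_space)
  then obtain n where "1 - e < prob (A n)" by (auto simp: eventually_sequentially)
  then show ?thesis using assms(1) by (intro exI[of _ n]) (subst prob_compl, auto)
qed

end

text \<open>Each \<open>f\<close> is uniformly continuous, so for fixed \<open>\<epsilon>\<close>
  the sets with \<open>\<delta> = 1 / Suc n\<close> increase to the whole space, and continuity of
  the measure from below applies.\<close>

lemma ex_small_oscillation_prob:
  fixes \<mu> :: "C01 measure"
  assumes "prob_space \<mu>" and sets: "sets \<mu> = sets borel" and "0 < \<epsilon>" "0 < e"
  shows "\<exists>\<delta>>0. measure \<mu> (- small_oscillation \<epsilon> \<delta>) < e"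
proof -
  interpret prob_space \<mu> by fact
  have sp: "space \<mu> = UNIV" using sets_eq_imp_space_eq[OF sets] by simp
  have "\<exists>n. prob (space \<mu> - small_oscillation \<epsilon> (1 / Suc n)) < e"
  proof (rule incseq_compl_prob_less)
    show "range (\<lambda>n. small_oscillation \<epsilon> (1 / Suc n)) \<subseteq> events"
      using closed_small_oscillation sets by auto
    show "incseq (\<lambda>n. small_oscillation \<epsilon> (1 / Suc n))"
      by (intro incseq_SucI small_oscillation_antimono) (auto simp: field_simps)
    have "\<exists>n. f \<in> small_oscillation \<epsilon> (1 / Suc n)" for f
    proof -
      obtain \<delta> where \<delta>: "\<delta> > 0" "f \<in> small_oscillation \<epsilon> \<delta>"
        using ex_small_oscillation[OF assms(3)] by blast
      obtain n where "1 / Suc n < \<delta>" using nat_approx_posE[OF \<delta>(1)] by blast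
      then show ?thesis using small_oscillation_antimono[of "1 / Suc n" \<delta>] \<delta>(2) by auto
    qed
    then show "(\<Union>n. small_oscillation \<epsilon> (1 / Suc n)) = space \<mu>" by (auto simp: sp)
  qed fact
  then obtain n where "prob (- small_oscillation \<epsilon> (1 / Suc n)) < e"
    by (auto simp: sp Compl_eq_Diff_UNIV)
  then show ?thesis by (intro exI[of _ "1 / Suc n"]) auto
qed

lemma ex_norm_bound_prob:
  fixes \<mu> :: "C01 measure"
  assumes "prob_space \<mu>" and sets: "sets \<mu> = sets borel" and "0 < e"
  shows "\<exists>R\<ge>0. measure \<mu> (- cball 0 R) < e"
proof -
  interpret prob_space \<mu> by fact
  have sp: "space \<mu> = UNIV" using sets_eq_imp_space_eq[OF sets] by simp
  have "\<exists>n. prob (space \<mu> - cball 0 (real n)) < e"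
  proof (rule incseq_compl_prob_less)
    show "range (\<lambda>n. cball 0 (real n)) \<subseteq> events"
      unfolding sets by (intro image_subsetI borel_closed closed_cball)
    show "incseq (\<lambda>n. cball (0 :: C01) (real n))" by (intro incseq_SucI subset_cball) simp
    show "(\<Union>n. cball 0 (real n)) = space \<mu>"
      unfolding sp using real_arch_simple[of "norm f" for f :: C01] by (intro set_eqI) simp
  qed fact
  then obtain n where "prob (- cball 0 (real n)) < e"
    by (auto simp: sp Compl_eq_Diff_UNIV)
  then show ?thesis by (intro exI[of _ "real n"]) auto
qed

section \<open>Fubini argument and non-shyness\<close>

text \<open>Asking for measurability of point evaluations only lets this serve both on
  \<open>borel\<close> with a fixed \<open>g u\<close> and on the product with
  \<open>lborel\<close>, where \<open>f\<close> and \<open>u\<close> vary together.\<close>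

lemma pred_is_singleton_zero_set_diff:
  fixes N :: "'a measure" and X Y :: "'a \<Rightarrow> C01"
  assumes [measurable]: "\<And>x. (\<lambda>w. apply_bcontfun (X w) x) \<in> borel_measurable N"
    "\<And>x. (\<lambda>w. apply_bcontfun (Y w) x) \<in> borel_measurable N"
  shows "Measurable.pred N (\<lambda>w. is_singleton (zero_set (X w - Y w)))"
  unfolding is_singleton_zero_set_iff
  by (rule pred_unique_zero) (simp_all add: continuous_on_apply_clamp01 minus_bcontfun.rep_eq continuous_on_diff)

lemma ex_positive_unique_zero:
  fixes \<mu> :: "C01 measure"
  assumes "prob_space \<mu>" and sets: "sets \<mu> = sets borel"
  shows "\<exists>g. 0 < measure \<mu> {f. is_singleton (zero_set (f - g))}"
proof (rule ccontr)
  assume contra: "\<nexists>g. 0 < measure \<mu> {f. is_singleton (zero_set (f - g))}"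
  interpret \<mu>: prob_space \<mu> by fact
  interpret pair_sigma_finite \<mu> lborel ..
  note [measurable_cong] = sets
  have sp: "space \<mu> = UNIV" using sets_eq_imp_space_eq[OF sets] by simp
  \<comment> \<open>The exceptional intervals have length \<open>6 * \<epsilon> k\<close>, in total
    3/4, less than the length 1 of \<open>{R<..<R+1}\<close>.\<close>
  define \<epsilon> :: "nat \<Rightarrow> real" where "\<epsilon> k = (1/2) ^ k / 16" for k
  have \<epsilon>_pos: "0 < \<epsilon> k" for k by (simp add: \<epsilon>_def)
  have "antimono \<epsilon>" unfolding \<epsilon>_def by (intro antimonoI divide_right_mono power_decreasing) auto
  obtain R where R: "0 \<le> R" "\<mu>.prob (- cball 0 R) < 1/4"
    using ex_norm_bound_prob[OF assms, of "1/4"] by auto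
  \<comment> \<open>The probabilities \<open>(1/2) ^ k / 8\<close> sum to 1/4; with the 1/4 lost to
    the norm bound, at most 1/2 is lost. The radius \<open>2 * \<delta>\<close> matches the
    \<open>2 * c k\<close> in the steep function's condition on \<open>F\<close>.\<close>
  define Q where "Q k \<delta> \<longleftrightarrow> 0 < \<delta> \<and> \<delta> \<le> 1/2 \<and>
    \<mu>.prob (- small_oscillation (\<epsilon> k) (2 * \<delta>)) \<le> (1/2) ^ k / 8" for k \<delta>
  have Q: "\<exists>\<delta>. Q k \<delta> \<and> \<delta> \<le> b" if "0 < b" for k b
  proof -
    obtain \<delta> where \<delta>: "\<delta> > 0" "\<mu>.prob (- small_oscillation (\<epsilon> k) \<delta>) < (1/2) ^ k / 8"
      using ex_small_oscillation_prob[OF assms \<epsilon>_pos[of k], of "(1/2) ^ k / 8"] by auto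
    define \<delta>' where "\<delta>' = min (\<delta> / 2) (min b (1/2))"
    have "\<mu>.prob (- small_oscillation (\<epsilon> k) (2 * \<delta>')) \<le> \<mu>.prob (- small_oscillation (\<epsilon> k) \<delta>)"
      using small_oscillation_antimono[of "2 * \<delta>'" \<delta> "\<epsilon> k"] closed_small_oscillation sets
      by (intro \<mu>.finite_measure_mono) (auto simp: \<delta>'_def)
    then show ?thesis
      using \<delta> that by (intro exI[of _ \<delta>']) (auto simp: Q_def \<delta>'_def)
  qed
  \<comment> \<open>\<open>Q k\<close> has arbitrarily small solutions, so halving can be imposed in
    a recursive choice.\<close>
  have "\<exists>c. \<forall>k. Q k (c k) \<and> c (Suc k) \<le> c k / 2"
  proof (rule dependent_nat_choice)
    show "\<exists>x. Q 0 x" using Q[of 1 0] by auto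
    show "\<exists>y. Q (Suc k) y \<and> y \<le> x / 2" if "Q k x" for x k
      using Q[of "x / 2" "Suc k"] that by (auto simp: Q_def)
  qed
  then obtain c where c: "\<And>k. Q k (c k)" "\<And>k. c (Suc k) \<le> c k / 2" by blast
  have c_pos: "0 < c k" for k using c(1)[of k] by (simp add: Q_def)
  have c0: "c 0 \<le> 1/2" using c(1)[of 0] by (simp add: Q_def)
  obtain \<phi> q p where \<phi>: "mono \<phi>" "continuous_on UNIV \<phi>"
    and unique: "\<forall>F u. continuous_on UNIV F \<and> (\<forall>x. \<bar>F x\<bar> \<le> R) \<and>
        (\<forall>k x y. \<bar>x - y\<bar> \<le> 2 * c k \<longrightarrow> \<bar>F x - F y\<bar> \<le> \<epsilon> k) \<and> R < u \<and> u < R + 1 \<and>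
        (\<forall>k. 3 * \<epsilon> k < \<bar>u - (q k - F (p k))\<bar>)
      \<longrightarrow> (\<exists>!x. x \<in> {0..1} \<and> \<phi> x - F x = u)"
    by (rule steep_function_exists[OF c_pos c(2) c0 R(1) \<epsilon>_pos \<open>antimono \<epsilon>\<close>])
  define g :: "real \<Rightarrow> C01" where "g u = Bcontfun (\<lambda>x. \<phi> (real_of_ui x) - u)" for u
  have g: "apply_bcontfun (g u) x = \<phi> (real_of_ui x) - u" for u x
  proof -
    have "norm (\<phi> (real_of_ui x) - u) \<le> \<bar>\<phi> 0\<bar> + \<bar>\<phi> 1\<bar> + \<bar>u\<bar>" for x
      using monoD[OF \<phi>(1), of 0 "real_of_ui x"] monoD[OF \<phi>(1), of "real_of_ui x" 1] by auto
    moreover have "continuous_on UNIV (\<lambda>x. \<phi> (real_of_ui x) - u)"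
      by (intro continuous_intros continuous_on_compose2[OF \<phi>(2) continuous_on_real_of_ui]) auto
    ultimately have "(\<lambda>x. \<phi> (real_of_ui x) - u) \<in> bcontfun"
      by (intro bcontfun_normI)
    then show ?thesis
      unfolding g_def by (simp add: Bcontfun_inverse)
  qed
  define S where "S f u \<longleftrightarrow> is_singleton (zero_set (f - g u))" for f u
  have meas: "Measurable.pred (\<mu> \<Otimes>\<^sub>M lborel) (\<lambda>w. \<not> S (fst w) (snd w))"
    unfolding S_def by (intro pred_intros_logic, rule pred_is_singleton_zero_set_diff) (simp_all add: g)
  have "AE f in \<mu>. \<not> S f u" for u
  proof -
    have "{f. S f u} \<in> sets \<mu>"
      using pred_is_singleton_zero_set_diff[of "\<lambda>f. f" borel "\<lambda>f. g u"]
      by (simp add: pred_def S_def sets)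
    moreover have "\<mu>.prob {f. S f u} = 0"
      using contra measure_nonneg[of \<mu>] unfolding S_def by (metis less_eq_real_def)
    ultimately have "{f. S f u} \<in> null_sets \<mu>"
      by (simp add: null_sets_def \<mu>.emeasure_eq_measure)
    then show ?thesis by (rule AE_I') auto
  qed
  then have "AE u in lborel. AE f in \<mu>. \<not> S f u" by simp
  \<comment> \<open>Fubini: from null sets of \<open>f\<close> for each \<open>u\<close> to
    Lebesgue-null sets of \<open>u\<close> for almost every \<open>f\<close>.\<close>
  then have AE: "AE f in \<mu>. AE u in lborel. \<not> S f u"
    using meas by (subst AE_commute) (auto simp: pred_def)
  define K where "K = cball 0 R \<inter> (\<Inter>k. small_oscillation (\<epsilon> k) (2 * c k))"
  \<comment> \<open>For \<open>f\<close> in \<open>K\<close>, the \<open>u\<close> in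
    \<open>{R<..<R+1}\<close> violating \<open>S f u\<close> are covered by total length 3/4, so
    they cannot be almost all of that interval.\<close>
  have "f \<notin> K" if "AE u in lborel. \<not> S f u" for f
  proof
    assume "f \<in> K"
    define F where "F x = apply_bcontfun f (clamp01 x)" for x
    have F1: "continuous_on UNIV F" unfolding F_def by (rule continuous_on_apply_clamp01)
    have F2: "\<bar>F x\<bar> \<le> R" for x
      using \<open>f \<in> K\<close> norm_bounded[of f "clamp01 x"] by (auto simp: K_def F_def)
    have F3: "\<bar>F x - F y\<bar> \<le> \<epsilon> k" if "\<bar>x - y\<bar> \<le> 2 * c k" for k x y
      using \<open>f \<in> K\<close> that dist_clamp01_le[of x y]
      unfolding K_def small_oscillation_def F_def by fastforce
    define a where "a k = q k - F (p k)" for k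
    define B where "B k = {a k - 3 * \<epsilon> k .. a k + 3 * \<epsilon> k}" for k
    have "u \<in> (\<Union>k. B k)" if "\<not> S f u" "u \<in> {R<..<R+1}" for u
    proof (rule ccontr)
      assume "u \<notin> (\<Union>k. B k)"
      then have "3 * \<epsilon> k < \<bar>u - a k\<bar>" for k
        by (simp add: B_def not_le abs_if) (smt (verit))
      then have "\<exists>!x. x \<in> {0..1} \<and> \<phi> x - F x = u"
        using that(2) by (intro unique[rule_format] conjI allI impI F1 F2 F3) (auto simp: a_def)
      moreover have "x \<in> {0..1} \<and> apply_bcontfun (f - g u) (clamp01 x) = 0 \<longleftrightarrow>
          x \<in> {0..1} \<and> \<phi> x - F x = u" for x
        by (auto simp: minus_bcontfun.rep_eq g real_of_clamp01 F_def)
      ultimately show False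
        using that(1) unfolding S_def is_singleton_zero_set_iff by simp
    qed
    then have "emeasure lborel {R<..<R+1} \<le> emeasure lborel (\<Union>k. B k)"
      using \<open>AE u in lborel. \<not> S f u\<close> by (intro emeasure_mono_AE) (auto simp: B_def)
    also have "\<dots> \<le> (\<Sum>k. emeasure lborel (B k))"
      by (intro emeasure_subadditive_countably) (auto simp: B_def)
    also have "\<dots> = (\<Sum>k. ennreal (6 * \<epsilon> k))"
      using less_imp_le[OF \<epsilon>_pos] by (simp add: B_def)
    also have "\<dots> = ennreal (3/4)"
    proof -
      have "(\<lambda>k. 6 * \<epsilon> k) sums (6/16 * (1 / (1 - 1/2)))"
        using sums_mult[OF geometric_sums[of "1/2 :: real"], of "6/16"] by (simp add: \<epsilon>_def)
      then show ?thesis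
        using less_imp_le[OF \<epsilon>_pos] by (subst suminf_ennreal2) (auto simp: sums_iff)
    qed
    finally have "ennreal 1 \<le> ennreal (3/4)" by simp
    then show False by (subst (asm) ennreal_le_iff) auto
  qed
  with AE have "AE f in \<mu>. f \<in> - K" by auto
  moreover have K_eq: "- K = - cball 0 R \<union> (\<Union>k. - small_oscillation (\<epsilon> k) (2 * c k))"
    by (auto simp: K_def)
  moreover have SO: "- small_oscillation e d \<in> sets \<mu>" for e d
    using closed_small_oscillation sets by (auto simp: open_Compl)
  ultimately have "\<mu>.prob (- K) = 1"
    using sets by (subst \<mu>.prob_eq_1) auto
  moreover have "\<mu>.prob (- K) \<le> 1/4 + 1/4"
  proof -
    have sums: "(\<lambda>k. (1/2) ^ k / 8 :: real) sums (1 / (1 - 1/2) / 8)"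
      by (intro sums_divide geometric_sums) simp
    have le: "\<mu>.prob (- small_oscillation (\<epsilon> k) (2 * c k)) \<le> (1/2) ^ k / 8" for k
      using c(1)[of k] by (simp add: Q_def)
    have summable: "summable (\<lambda>k. \<mu>.prob (- small_oscillation (\<epsilon> k) (2 * c k)))"
      using le by (intro summable_comparison_test'[OF sums_summable[OF sums], of 0]) auto
    have "\<mu>.prob (\<Union>k. - small_oscillation (\<epsilon> k) (2 * c k))
        \<le> (\<Sum>k. \<mu>.prob (- small_oscillation (\<epsilon> k) (2 * c k)))"
      using SO summable by (intro \<mu>.finite_measure_subadditive_countably) auto
    also have "\<dots> \<le> (\<Sum>k. (1/2) ^ k / 8)"
      by (intro suminf_le le summable sums_summable[OF sums])
    also have "\<dots> = 1/4" using sums by (simp add: sums_iff)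
    finally show ?thesis
      unfolding K_eq using R(2) SO sets
      by (intro order_trans[OF measure_Un_le]) auto
  qed
  ultimately show False by simp
qed

theorem theorem5p2:
  shows "(\<forall>\<mu> :: C01 measure. prob_space \<mu> \<and> sets \<mu> = sets borel \<longrightarrow>
            (\<exists>g :: C01. measure \<mu> {f. is_singleton (zero_set (f - g))} > 0))
         \<and> \<not> shy {f :: C01. is_singleton (zero_set f)}"
proof (intro conjI allI impI notI)
  fix \<mu> :: "C01 measure"
  assume "prob_space \<mu> \<and> sets \<mu> = sets borel"
  then show "\<exists>g. measure \<mu> {f. is_singleton (zero_set (f - g))} > 0"
    using ex_positive_unique_zero by blast
next
  assume "shy {f :: C01. is_singleton (zero_set f)}"
  then obtain B \<nu> where B: "B \<in> sets (borel :: C01 measure)" "{f. is_singleton (zero_set f)} \<subseteq> B"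
    and \<nu>: "prob_space \<nu>" "sets \<nu> = sets borel" and null: "\<And>x. emeasure \<nu> ((\<lambda>b. b + x) ` B) = 0"
    unfolding shy_def by blast
  interpret prob_space \<nu> by fact
  obtain g where g: "0 < prob {f. is_singleton (zero_set (f - g))}"
    using ex_positive_unique_zero[OF \<nu>] by blast
  \<comment> \<open>As a preimage the translate is visibly Borel, and it contains every
    \<open>f\<close> for which \<open>f - g\<close> has exactly one zero; its measure 0 then
    contradicts the choice of \<open>g\<close>.\<close>
  have eq: "(\<lambda>b. b + g) ` B = (\<lambda>f. f - g) -` B"
    by (force simp: image_iff)
  have "(\<lambda>f. f - g) -` B \<inter> space borel \<in> sets borel"
    by (rule measurable_sets[OF _ B(1)])
      (intro borel_measurable_continuous_onI continuous_intros)
  then have "prob {f. is_singleton (zero_set (f - g))} \<le> prob ((\<lambda>b. b + g) ` B)"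
    unfolding eq using B(2) \<nu>(2) by (intro finite_measure_mono) auto
  also have "\<dots> = 0" using null by (simp add: measure_def)
  finally show False using g by simp
qed

end
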